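(* Let $I$ be a graph with vertex set $V$, $|V|=n\ge 1$, and let $\mathcal{P}$ be any class of nonempty subsets of $V$ that contains a dominating set of $I$. Then the interference index satisfies $$\lceil \log_2(n+1)\rceil\le i(I,\mathcal{P}) \le \lceil \log_2 (2n)\rceil.$$ Moreover, the universal interference index with respect to the complete graph $K_n$ is $i(K_n)=\lceil\log_2 (2n)\rceil$.
   Context: All graphs are finite and simple. Let $I$ be a graph with vertex set $V$ and let $X$ be a nonempty set (the ground set). An injective function $f: V\to 2^X\setminus\{\emptyset\}$ is an interference of a set $\emptyset\neq D\subseteq V$ with respect to $I$ if for every $u\in V\setminus D$ there exists $v\in D$ adjacent to $u$ in $I$ with $f(u)\cap f(v)\neq\emptyset$. A dominating set of $I$ is a nonempty $D\subseteq V$ such that every vertex is in $D$ or adjacent in $I$ to a vertex of $D$; only dominating sets can have an interference. For a class $\mathcal{P}$ of nonempty subsets of $V$ containing at least one dominating set, the interference index $i(I,\mathcal{P})$ is the smallest size $|X|$ of a ground set $X$ for which there is an injective $f: V\to 2^X\setminus\{\emptyset\}$ that is an interference with respect to $I$ of every dominating set belonging to $\mathcal{P}$. The universal interference index is $i(I):=i(I,2^V\setminus\{\emptyset\})$, i.e. the smallest $|X|$ admitting an $f$ that is an interference of every dominating set of $I$. *)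

theory Defs
  imports Complex_Main "Graph_Theory.Graph_Theory"
begin

text \<open>
  Finite simple graphs are the locale \<open>graph\<close> of the Graph_Theory library: finite, loop-free
  digraphs without multiple arcs whose adjacency relation is symmetric.  Adjacency of \<open>u\<close> and
  \<open>v\<close> in \<open>G\<close> is \<open>u \<rightarrow>\<^bsub>G\<^esub> v\<close>, and \<open>complete_digraph n K\<close> says that
  \<open>K\<close> is a complete graph on \<open>n\<close> vertices.
\<close>

definition dominating_set :: "('a, 'b) pre_digraph \<Rightarrow> 'a set \<Rightarrow> bool" where
  "dominating_set G D \<longleftrightarrow>
     D \<noteq> {} \<and> D \<subseteq> verts G \<and> (\<forall>u \<in> verts G. u \<in> D \<or> (\<exists>v \<in> D. u \<rightarrow>\<^bsub>G\<^esub> v))"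

definition set_labelling :: "('a, 'b) pre_digraph \<Rightarrow> 'x set \<Rightarrow> ('a \<Rightarrow> 'x set) \<Rightarrow> bool" where
  "set_labelling G X f \<longleftrightarrow> f ` verts G \<subseteq> Pow X - {{}} \<and> inj_on f (verts G)"

definition interference ::
  "('a, 'b) pre_digraph \<Rightarrow> 'x set \<Rightarrow> ('a \<Rightarrow> 'x set) \<Rightarrow> 'a set \<Rightarrow> bool" where
  "interference G X f D \<longleftrightarrow>
     set_labelling G X f \<and> D \<noteq> {} \<and> D \<subseteq> verts G \<and>
     (\<forall>u \<in> verts G - D. \<exists>v \<in> D. u \<rightarrow>\<^bsub>G\<^esub> v \<and> f u \<inter> f v \<noteq> {})"

text \<open>
  The labelling condition is stated separately from \<open>interference\<close> so that \<open>f\<close> is a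
  labelling even when \<open>\<P>\<close> contains no dominating set.
\<close>

definition admits_interference ::
  "('a, 'b) pre_digraph \<Rightarrow> 'a set set \<Rightarrow> 'x set \<Rightarrow> bool" where
  "admits_interference G \<P> X \<longleftrightarrow>
     X \<noteq> {} \<and>
     (\<exists>f. set_labelling G X f \<and> (\<forall>D \<in> \<P>. dominating_set G D \<longrightarrow> interference G X f D))"

text \<open>
  Only the size of the ground set matters, so it is taken among the finite sets of natural
  numbers (\<open>card\<close> is 0 on infinite sets, hence the explicit finiteness).
  The lemma after the definitions shows that the minimum is over a nonempty set.
\<close>

definition interference_index :: "('a, 'b) pre_digraph \<Rightarrow> 'a set set \<Rightarrow> nat" where
  "interference_index G \<P> =
     (LEAST k. \<exists>X :: nat set. finite X \<and> card X = k \<and> admits_interference G \<P> X)"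

definition universal_interference_index :: "('a, 'b) pre_digraph \<Rightarrow> nat" where
  "universal_interference_index G = interference_index G (Pow (verts G) - {{}})"

lemma ex_admits_interference:
  assumes "graph G"
  shows "\<exists>X :: nat set. finite X \<and> admits_interference G \<P> X"
proof -
  interpret graph G by fact
  obtain e :: "'a \<Rightarrow> nat" where e: "inj_on e (verts G)"
    using finite_imp_inj_to_nat_seg[OF finite_verts] by blast
  define X where "X = insert 0 (Suc ` e ` verts G)"
  define f where "f = (\<lambda>v. {0, Suc (e v)})"
  have lab: "set_labelling G X f"
    using e by (auto simp: set_labelling_def X_def f_def inj_on_def doubleton_eq_iff)
  have "interference G X f D" if "dominating_set G D" for D
    using that lab unfolding interference_def dominating_set_def
    by (auto simp: f_def)
  with lab have "admits_interference G \<P> X"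
    unfolding admits_interference_def X_def by blast
  moreover have "finite X"
    by (simp add: X_def)
  ultimately show ?thesis
    by blast
qed

end

theory Submission
  imports Defs
begin

text \<open>
  Everything reduces to counting subsets of a ground set of size \<open>k\<close>, since a ceiling of a
  binary logarithm compares with \<open>k\<close> as its argument compares with \<open>2 ^ k\<close>
  (\<open>ceiling_log2_le_iff\<close>).

  Lower bound: a labelling injects the \<open>n\<close> vertices into the \<open>2 ^ k - 1\<close> nonempty subsets.

  Upper bound: the \<open>2 ^ (k - 1)\<close> subsets that contain one chosen point meet pairwise.  If all
  labels are of this form, adjacent vertices always have meeting labels, so domination and
  interference coincide and one labelling serves every dominating set at once
  (\<open>admits_interference_if_le_power2\<close>).

  Complete graphs: each single vertex dominates, and its interference forces the labels to meet
  pairwise.  Such a family never contains a set together with its complement, so it has at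
  most \<open>2 ^ (k - 1)\<close> members (\<open>card_pairwise_meeting_le\<close>) and the upper bound is sharp.
\<close>

lemma ceiling_log2_le_iff:
  assumes "m \<ge> 1"
  shows "\<lceil>log 2 (real m)\<rceil> \<le> int k \<longleftrightarrow> m \<le> 2 ^ k"
proof -
  have "\<lceil>log 2 (real m)\<rceil> \<le> int k \<longleftrightarrow> real m \<le> 2 ^ k"
    using assms by (simp add: ceiling_le_iff log_le_iff powr_realpow)
  also have "\<dots> \<longleftrightarrow> m \<le> 2 ^ k"
    by (metis of_nat_le_iff of_nat_numeral of_nat_power)
  finally show ?thesis .
qed

lemma interference_index_le:
  fixes X :: "nat set"
  assumes "finite X" "admits_interference G \<P> X"
  shows "interference_index G \<P> \<le> card X"
  unfolding interference_index_def using assms by (intro Least_le) auto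

lemma interference_index_attained:
  assumes "graph G"
  obtains X :: "nat set" where
    "finite X" "card X = interference_index G \<P>" "admits_interference G \<P> X"
proof -
  let ?P = "\<lambda>k. \<exists>X :: nat set. finite X \<and> card X = k \<and> admits_interference G \<P> X"
  have "\<exists>k. ?P k"
    using ex_admits_interference[OF assms] by blast
  then have "?P (LEAST k. ?P k)"
    by (rule LeastI_ex)
  then show thesis
    unfolding interference_index_def[symmetric] using that by blast
qed

lemma card_verts_less_power2:
  assumes "finite X" "set_labelling G X f"
  shows "card (verts G) + 1 \<le> 2 ^ card X"
proof -
  have "card (verts G) = card (f ` verts G)"
    using assms(2) by (simp add: set_labelling_def card_image)
  also have "\<dots> \<le> card (Pow X - {{}})"
    using assms by (intro card_mono) (auto simp: set_labelling_def)
  also have "\<dots> = 2 ^ card X - 1"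
    using assms(1) by (simp add: card_Diff_singleton card_Pow)
  finally show ?thesis
    using one_le_power[of "2::nat" "card X"] by linarith
qed

text \<open>
  Any sets sharing a point will do as labels; the subsets of \<open>{..k}\<close> through \<open>0\<close> are as
  many as the subsets of the remaining \<open>k\<close> points.
\<close>

lemma admits_interference_if_le_power2:
  assumes "finite (verts G)" "card (verts G) \<le> 2 ^ k"
  shows "admits_interference G \<P> {..k}"
proof -
  have "card (verts G) \<le> card (Pow {1..k})"
    using assms(2) by (simp add: card_Pow)
  with assms(1) obtain g where g: "g ` verts G \<subseteq> Pow {1..k}" "inj_on g (verts G)"
    by (meson card_le_inj finite_Pow_iff finite_atLeastAtMost)
  define f where "f = (\<lambda>v. insert 0 (g v))"
  have "0 \<notin> g v" if "v \<in> verts G" for v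
    using g(1) that by fastforce
  then have "inj_on f (verts G)"
    using g(2) unfolding inj_on_def f_def by (metis insert_ident)
  moreover have "f ` verts G \<subseteq> Pow {..k} - {{}}"
    using g(1) by (fastforce simp: f_def)
  ultimately have lab: "set_labelling G {..k} f"
    by (simp add: set_labelling_def)
  moreover have "interference G {..k} f D" if "dominating_set G D" for D
    using that lab unfolding interference_def dominating_set_def by (auto simp: f_def)
  ultimately show ?thesis
    unfolding admits_interference_def by blast
qed

text \<open>
  Complementation maps the family injectively to a family of subsets disjoint from it, so the
  family fills at most half of the power set.  Taking \<open>A = B\<close> in the hypothesis excludes
  the empty set, as is necessary: \<open>{{}}\<close> would violate the bound over the empty ground set.
\<close>

lemma card_pairwise_meeting_le:
  assumes "finite X" "\<F> \<subseteq> Pow X"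
    and meet: "\<And>A B. A \<in> \<F> \<Longrightarrow> B \<in> \<F> \<Longrightarrow> A \<inter> B \<noteq> {}"
  shows "2 * card \<F> \<le> 2 ^ card X"
proof -
  let ?C = "(\<lambda>A. X - A) ` \<F>"
  have fin: "finite \<F>"
    using assms(1,2) finite_subset by blast
  have "inj_on (\<lambda>A. X - A) \<F>"
    using assms(2) by (intro inj_onI) blast
  then have "card ?C = card \<F>"
    by (rule card_image)
  moreover have "\<F> \<inter> ?C = {}"
    using meet by blast
  ultimately have "2 * card \<F> = card (\<F> \<union> ?C)"
    using fin by (simp add: card_Un_disjoint)
  also have "\<dots> \<le> card (Pow X)"
    using assms(1,2) by (intro card_mono) auto
  finally show ?thesis
    using assms(1) by (simp add: card_Pow)
qed

lemma complete_digraph_adj: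
  assumes "complete_digraph n K" "u \<in> verts K" "v \<in> verts K" "u \<noteq> v"
  shows "u \<rightarrow>\<^bsub>K\<^esub> v"
  using assms unfolding complete_digraph_def by auto

lemma card_complete_digraph_le:
  assumes K: "complete_digraph n K" and "finite X"
    and adm: "admits_interference K (Pow (verts K) - {{}}) X"
  shows "2 * n \<le> 2 ^ card X"
proof -
  obtain f where lab: "set_labelling K X f"
    and int: "\<And>D. D \<subseteq> verts K \<Longrightarrow> D \<noteq> {} \<Longrightarrow> dominating_set K D \<Longrightarrow> interference K X f D"
    using adm unfolding admits_interference_def by blast
  have meet: "f u \<inter> f v \<noteq> {}" if u: "u \<in> verts K" and v: "v \<in> verts K" for u v
  proof (cases "u = v")
    case True
    then show ?thesis
      using lab v by (auto simp: set_labelling_def)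
  next
    case False
    have "dominating_set K {v}"
      using v complete_digraph_adj[OF K] by (auto simp: dominating_set_def)
    then have "interference K X f {v}"
      using v by (intro int) auto
    then show ?thesis
      using u False by (auto simp: interference_def)
  qed
  have "card (f ` verts K) = n"
    using lab K by (simp add: set_labelling_def card_image complete_digraph_def)
  moreover have "2 * card (f ` verts K) \<le> 2 ^ card X"
    using lab meet by (intro card_pairwise_meeting_le[OF \<open>finite X\<close>])
      (auto simp: set_labelling_def)
  ultimately show ?thesis
    by simp
qed

lemma interference_index_le_ceiling_log2:
  assumes "finite (verts G)" "card (verts G) \<ge> 1"
  shows "int (interference_index G \<P>) \<le> \<lceil>log 2 (2 * real (card (verts G)))\<rceil>"
proof -
  let ?n = "card (verts G)"
  define k where "k = nat \<lceil>log 2 (real ?n)\<rceil>"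
  have k: "int k = \<lceil>log 2 (real ?n)\<rceil>"
  proof -
    have "0 \<le> log 2 (real ?n)"
      using assms(2) by simp
    then have "0 \<le> \<lceil>log 2 (real ?n)\<rceil>"
      by linarith
    then show ?thesis
      by (simp add: k_def)
  qed
  then have "?n \<le> 2 ^ k"
    using ceiling_log2_le_iff[OF assms(2), of k] by simp
  then have "interference_index G \<P> \<le> card {..k}"
    using assms(1) by (intro interference_index_le admits_interference_if_le_power2) auto
  \<comment> \<open>Doubling \<open>?n\<close> adds \<open>1\<close> to the logarithm; this pays for the common point of the labels.\<close>
  moreover have "\<lceil>log 2 (2 * real ?n)\<rceil> = int (Suc k)"
    using k assms(2) by (simp add: log_mult add.commute[of 1])
  ultimately show ?thesis
    by simp
qed

theorem theorem3p2:
  fixes n :: nat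
  assumes "n \<ge> 1"
  shows
    "(\<forall>(G :: ('a, 'b) pre_digraph) (\<P> :: 'a set set).
        graph G \<longrightarrow> card (verts G) = n \<longrightarrow>
        \<P> \<subseteq> Pow (verts G) - {{}} \<longrightarrow> (\<exists>D \<in> \<P>. dominating_set G D) \<longrightarrow>
          \<lceil>log 2 (real n + 1)\<rceil> \<le> int (interference_index G \<P>) \<and>
          int (interference_index G \<P>) \<le> \<lceil>log 2 (2 * real n)\<rceil>) \<and>
     (\<forall>K :: ('c, 'd) pre_digraph.
        complete_digraph n K \<longrightarrow>
          int (universal_interference_index K) = \<lceil>log 2 (2 * real n)\<rceil>)"
proof (intro conjI allI impI)
  fix G :: "('a, 'b) pre_digraph" and \<P> :: "'a set set"
  assume G: "graph G" and n: "card (verts G) = n"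
  interpret graph G by (fact G)
  obtain X :: "nat set" and f where "finite X" "card X = interference_index G \<P>"
    "set_labelling G X f"
    using interference_index_attained[OF G, of \<P>] unfolding admits_interference_def by metis
  then have "n + 1 \<le> 2 ^ interference_index G \<P>"
    using card_verts_less_power2[of X G f] n by simp
  then show "\<lceil>log 2 (real n + 1)\<rceil> \<le> int (interference_index G \<P>)"
    using ceiling_log2_le_iff[of "n + 1"] by (simp add: add.commute)
  show "int (interference_index G \<P>) \<le> \<lceil>log 2 (2 * real n)\<rceil>"
    using interference_index_le_ceiling_log2[of G \<P>] n assms by simp
next
  fix K :: "('c, 'd) pre_digraph"
  assume K: "complete_digraph n K"
  then have "graph K"
    by (simp add: complete_digraph_def)
  then interpret graph K .
  have card: "card (verts K) = n"
    using K by (simp add: complete_digraph_def)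
  obtain X :: "nat set" where "finite X" "card X = universal_interference_index K"
    "admits_interference K (Pow (verts K) - {{}}) X"
    using interference_index_attained[OF \<open>graph K\<close>]
    unfolding universal_interference_index_def by metis
  then have "2 * n \<le> 2 ^ universal_interference_index K"
    using card_complete_digraph_le[OF K] by metis
  then have "\<lceil>log 2 (2 * real n)\<rceil> \<le> int (universal_interference_index K)"
    using ceiling_log2_le_iff[of "2 * n"] assms by simp
  moreover have "int (universal_interference_index K) \<le> \<lceil>log 2 (2 * real n)\<rceil>"
    unfolding universal_interference_index_def
    using interference_index_le_ceiling_log2[of K] card assms by simp
  ultimately show "int (universal_interference_index K) = \<lceil>log 2 (2 * real n)\<rceil>"
    by simp
qed

end
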